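(* Let a concurrent program, an initial state $s_0$ and a safety property $\psi$ be given (setting described in the context). Consider the algorithm that calls $\mathsf{Explore}(s_0)$, where $\mathsf{Explore}(s)$, for $s$ at global program point $\ell$, returns a formula as follows: (1) if some formula $\overline{\Psi}$ has previously been memoized for $\ell$ with $s\models\overline{\Psi}$, return $\overline{\Psi}$; (2) if $s\not\models\psi$, report an error and terminate the whole search; (3) $\overline{\Psi}:=\psi$; (4) $\langle T,\overline{\Psi}_{trace}\rangle:=\mathsf{Persistent\_Set}(\ell)$; (5) if $s\models\overline{\Psi}_{trace}$ then $Ts:=T$ and $\overline{\Psi}:=\overline{\Psi}\wedge\overline{\Psi}_{trace}$, else $Ts:=Schedulable(s)$; (6) for each $t\in Ts\setminus Enabled(s)$: $\overline{\Psi}:=\overline{\Psi}\wedge \mathsf{pre}(t,\mathit{false})$; (7) for each $t\in Ts\cap Enabled(s)$: compute $s\xrightarrow{t}s'$, let $\overline{\Psi}':=\mathsf{Explore}(s')$ and set $\overline{\Psi}:=\overline{\Psi}\wedge\mathsf{pre}(t,\overline{\Psi}')$; (8) memoize $\overline{\Psi}$ for $\ell$ and return $\overline{\Psi}$. This algorithm is sound: if it finishes without reporting an error, then every state reachable from $s_0$ satisfies $\psi$.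
   Context: A concurrent program consists of finitely many processes $P_1,\dots,P_n$. Each $P_i$ has a finite set $trans_i$ of transitions whose control-flow graph is acyclic; the sets $trans_i$ are pairwise disjoint, and $\mathcal{T}=\bigcup_i trans_i$. Variables are shared variables plus local variables of each process, including a program counter $pc_i$. A (symbolic) state $s$ consists of a global program point $\mathtt{pc}(s)=\langle pc_1,\dots,pc_n\rangle$ and a first-order constraint $[\![s]\!]$ over the program variables; $s\models\varphi$ means $[\![s]\!]$ implies $\varphi$. A state is infeasible if $[\![s]\!]$ is unsatisfiable; an infeasible state satisfies every formula. A transition $t$ of $P_i$ moves $P_i$ from local location $\ell_1$ to $\ell_2$, is guarded by a condition $\mathit{cond}$ and has an effect on the variables; $t$ is schedulable at $s$ if $\mathtt{pc}(s)[i]=\ell_1$ (this depends only on $\mathtt{pc}(s)$, so one also speaks of transitions schedulable at a program point), and enabled at $s$ if moreover $s\models\mathit{cond}$. $Schedulable(s)$ and $Enabled(s)$ denote these sets. Executing a schedulable transition $t$ from $s$ yields a state $s'$ (written $s\xrightarrow{t}s'$); if $t$ is not enabled, $s'$ is infeasible. A state with no schedulable transitions is terminal. $s\stackrel{\theta}{\Longrightarrow}s'$ denotes a derivation along $\theta\in\mathcal{T}^*$. An (execution) trace is a sequence $\rho$ with $s_0\stackrel{\rho}{\Longrightarrow}s_f$, $s_f$ terminal; $\rho\models\psi$ means all its states satisfy $\psi$. For $t_1,t_2\in\mathcal{T}$, $t_1$ can de-schedule $t_2$ iff there is a state at which both are schedulable but $t_2$ is not schedulable after executing $t_1$. Trace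 coverage: $\rho_1\sqsupseteq_\psi\rho_2$ iff $\rho_1\models\psi$ implies $\rho_2\models\psi$. Semi-commutativity after a state: given a derivation $s_0\stackrel{\theta}{\Longrightarrow}s$ and $t_1,t_2$ that cannot de-schedule each other, $t_1$ semi-commutes with $t_2$ after $s$ wrt $\sqsupseteq_\psi$ iff for all $w_1,w_2\in\mathcal{T}^*$ such that $\theta w_1t_1t_2w_2$ and $\theta w_1t_2t_1w_2$ are execution traces, $\theta w_1t_1t_2w_2\sqsupseteq_\psi\theta w_1t_2t_1w_2$. Persistent set of a program point: a set $T$ of transitions schedulable at program point $\ell$ is persistent at $\ell$ under the formula $\overline{\Psi}$ wrt $\psi$ iff for every state $s$ at program point $\ell$ reachable from $s_0$ with $s\models\overline{\Psi}$, and every derivation $s\xrightarrow{t_1}s_1\cdots\xrightarrow{t_m}s_m$ with all $t_i\in\mathcal{T}\setminus T$, each transition of $T$ semi-commutes with each $t_i$ after $s$ wrt $\sqsupseteq_\psi$. $\mathsf{Persistent\_Set}(\ell)$ returns a (statically computed) pair $\langle T,\overline{\Psi}_{trace}\rangle$ such that $T$ is persistent at $\ell$ under $\overline{\Psi}_{trace}$ wrt $\psi$. $\mathsf{pre}(t,\varphi)$ is a safe approximation of the weakest precondition of $\varphi$ wrt transition $t$: every state satisfying $\mathsf{pre}(t,\varphi)$ is transformed by $t$ into a state satisfying $\varphi$.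
   Formalization: The formal theorem additionally assumes that Persistent_Set(ℓ) returns a nonempty T whenever some transition is schedulable at ℓ; with T = ∅ and a true trace formula (vacuously persistent) the algorithm explores nothing and the claim fails. *)

theory Defs
  imports Main
begin

text \<open>
  Processes are indexed by a finite type \<open>'p\<close>, \<open>'l\<close> is the type of local locations, \<open>'t\<close> the type
  of transition names.  The program counters \<open>pc\<^sub>i\<close> are the components of a program point; all other
  variables are evaluated by a store.  Formulas are represented by the predicates they denote on
  valuations of all program variables, the program counters included.
\<close>

datatype ('p, 'v) var = Shared 'v | Local 'p 'v

type_synonym ('p, 'l) point = "'p \<Rightarrow> 'l"

type_synonym ('p, 'v, 'd) store = "('p, 'v) var \<Rightarrow> 'd"

type_synonym ('p, 'l, 'v, 'd) form = "('p, 'l) point \<times> ('p, 'v, 'd) store \<Rightarrow> bool"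

definition form_conj ::
  "('p, 'l, 'v, 'd) form \<Rightarrow> ('p, 'l, 'v, 'd) form \<Rightarrow> ('p, 'l, 'v, 'd) form" (infixr "\<and>\<^sub>f" 65)
  where "\<phi> \<and>\<^sub>f \<chi> = (\<lambda>\<sigma>. \<phi> \<sigma> \<and> \<chi> \<sigma>)"

definition form_Conj :: "('p, 'l, 'v, 'd) form set \<Rightarrow> ('p, 'l, 'v, 'd) form"
  where "form_Conj \<Phi> = (\<lambda>\<sigma>. \<forall>\<phi>\<in>\<Phi>. \<phi> \<sigma>)"

definition form_false :: "('p, 'l, 'v, 'd) form"
  where "form_false = (\<lambda>\<sigma>. False)"

text \<open>
  In a symbolic state the values of the program counters are fixed by the program point, so its
  constraint is given by the set of stores that satisfy it; it is infeasible if this set is empty.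
\<close>

datatype ('p, 'l, 'v, 'd) state =
  State (pc: "('p, 'l) point") (constr: "('p, 'v, 'd) store set")

definition sat :: "('p, 'l, 'v, 'd) state \<Rightarrow> ('p, 'l, 'v, 'd) form \<Rightarrow> bool" (infix "\<Turnstile>" 50)
  where "s \<Turnstile> \<phi> \<longleftrightarrow> (\<forall>\<sigma>\<in>constr s. \<phi> (pc s, \<sigma>))"

text \<open>The effect of a transition may be nondeterministic: it yields the set of possible new stores.\<close>

record ('p, 'l, 't, 'v, 'd) program =
  transitions :: "'p \<Rightarrow> 't set"
  src :: "'t \<Rightarrow> 'l"
  tgt :: "'t \<Rightarrow> 'l"
  cond :: "'t \<Rightarrow> ('p, 'l, 'v, 'd) form"
  effect :: "'t \<Rightarrow> ('p, 'l) point \<times> ('p, 'v, 'd) store \<Rightarrow> ('p, 'v, 'd) store set"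

definition all_transitions :: "('p, 'l, 't, 'v, 'd) program \<Rightarrow> 't set"
  where "all_transitions P = (\<Union>i. transitions P i)"

definition concurrent_program :: "('p::finite, 'l, 't, 'v, 'd) program \<Rightarrow> bool"
  where "concurrent_program P \<longleftrightarrow>
    (\<forall>i. finite (transitions P i)) \<and>
    (\<forall>i j. i \<noteq> j \<longrightarrow> transitions P i \<inter> transitions P j = {}) \<and>
    (\<forall>i. acyclic ((\<lambda>t. (src P t, tgt P t)) ` transitions P i))"

definition schedulable_at :: "('p, 'l, 't, 'v, 'd) program \<Rightarrow> ('p, 'l) point \<Rightarrow> 't set"
  where "schedulable_at P pp = {t. \<exists>i. t \<in> transitions P i \<and> pp i = src P t}"

definition schedulable :: "('p, 'l, 't, 'v, 'd) program \<Rightarrow> ('p, 'l, 'v, 'd) state \<Rightarrow> 't set"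
  where "schedulable P s = schedulable_at P (pc s)"

definition enabled :: "('p, 'l, 't, 'v, 'd) program \<Rightarrow> ('p, 'l, 'v, 'd) state \<Rightarrow> 't set"
  where "enabled P s = {t \<in> schedulable P s. s \<Turnstile> cond P t}"

definition terminal :: "('p, 'l, 't, 'v, 'd) program \<Rightarrow> ('p, 'l, 'v, 'd) state \<Rightarrow> bool"
  where "terminal P s \<longleftrightarrow> schedulable P s = {}"

text \<open>
  Every schedulable transition can be executed; executing one that is not enabled leads to an
  infeasible state.
\<close>

definition step ::
  "('p, 'l, 't, 'v, 'd) program \<Rightarrow> ('p, 'l, 'v, 'd) state \<Rightarrow> 't \<Rightarrow> ('p, 'l, 'v, 'd) state \<Rightarrow> bool"
  where "step P s t s' \<longleftrightarrow>
    (\<exists>i. t \<in> transitions P i \<and> pc s i = src P t \<and>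
         s' = State ((pc s)(i := tgt P t))
                (if t \<in> enabled P s then (\<Union>\<sigma>\<in>constr s. effect P t (pc s, \<sigma>)) else {}))"

inductive derivation ::
  "('p, 'l, 't, 'v, 'd) program \<Rightarrow>
     ('p, 'l, 'v, 'd) state \<Rightarrow> 't list \<Rightarrow> ('p, 'l, 'v, 'd) state \<Rightarrow> bool"
  for P
where
  derivation_Nil: "derivation P s [] s"
| derivation_Cons: "step P s t s' \<Longrightarrow> derivation P s' \<theta> s'' \<Longrightarrow> derivation P s (t # \<theta>) s''"

definition reachable ::
  "('p, 'l, 't, 'v, 'd) program \<Rightarrow> ('p, 'l, 'v, 'd) state \<Rightarrow> ('p, 'l, 'v, 'd) state \<Rightarrow> bool"
  where "reachable P s\<^sub>0 s \<longleftrightarrow> (\<exists>\<theta>. derivation P s\<^sub>0 \<theta> s)"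

definition is_trace :: "('p, 'l, 't, 'v, 'd) program \<Rightarrow> ('p, 'l, 'v, 'd) state \<Rightarrow> 't list \<Rightarrow> bool"
  where "is_trace P s\<^sub>0 \<rho> \<longleftrightarrow> (\<exists>s\<^sub>f. derivation P s\<^sub>0 \<rho> s\<^sub>f \<and> terminal P s\<^sub>f)"

definition trace_sat ::
  "('p, 'l, 't, 'v, 'd) program \<Rightarrow> ('p, 'l, 'v, 'd) state \<Rightarrow> 't list \<Rightarrow> ('p, 'l, 'v, 'd) form \<Rightarrow> bool"
  where "trace_sat P s\<^sub>0 \<rho> \<psi> \<longleftrightarrow>
    (\<forall>\<rho>\<^sub>1 \<rho>\<^sub>2 s. \<rho> = \<rho>\<^sub>1 @ \<rho>\<^sub>2 \<longrightarrow> derivation P s\<^sub>0 \<rho>\<^sub>1 s \<longrightarrow> s \<Turnstile> \<psi>)"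

definition covers ::
  "('p, 'l, 't, 'v, 'd) program \<Rightarrow> ('p, 'l, 'v, 'd) state \<Rightarrow> ('p, 'l, 'v, 'd) form \<Rightarrow>
     't list \<Rightarrow> 't list \<Rightarrow> bool"
  where "covers P s\<^sub>0 \<psi> \<rho>\<^sub>1 \<rho>\<^sub>2 \<longleftrightarrow> (trace_sat P s\<^sub>0 \<rho>\<^sub>1 \<psi> \<longrightarrow> trace_sat P s\<^sub>0 \<rho>\<^sub>2 \<psi>)"

definition can_deschedule :: "('p, 'l, 't, 'v, 'd) program \<Rightarrow> 't \<Rightarrow> 't \<Rightarrow> bool"
  where "can_deschedule P t\<^sub>1 t\<^sub>2 \<longleftrightarrow>
    (\<exists>s s'. t\<^sub>1 \<in> schedulable P s \<and> t\<^sub>2 \<in> schedulable P s \<and>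
            step P s t\<^sub>1 s' \<and> t\<^sub>2 \<notin> schedulable P s')"

text \<open>
  Semi-commutativity after the state reached from \<open>s\<^sub>0\<close> along \<open>\<theta>\<close>.  It is only defined for
  transitions that cannot de-schedule each other, hence false for all other pairs.
\<close>

definition semi_commutes_after ::
  "('p, 'l, 't, 'v, 'd) program \<Rightarrow> ('p, 'l, 'v, 'd) state \<Rightarrow> ('p, 'l, 'v, 'd) form \<Rightarrow>
     't list \<Rightarrow> 't \<Rightarrow> 't \<Rightarrow> bool"
  where "semi_commutes_after P s\<^sub>0 \<psi> \<theta> t\<^sub>1 t\<^sub>2 \<longleftrightarrow>
    \<not> can_deschedule P t\<^sub>1 t\<^sub>2 \<and> \<not> can_deschedule P t\<^sub>2 t\<^sub>1 \<and>
    (\<forall>w\<^sub>1 w\<^sub>2. is_trace P s\<^sub>0 (\<theta> @ w\<^sub>1 @ [t\<^sub>1, t\<^sub>2] @ w\<^sub>2) \<longrightarrow>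
              is_trace P s\<^sub>0 (\<theta> @ w\<^sub>1 @ [t\<^sub>2, t\<^sub>1] @ w\<^sub>2) \<longrightarrow>
              covers P s\<^sub>0 \<psi> (\<theta> @ w\<^sub>1 @ [t\<^sub>1, t\<^sub>2] @ w\<^sub>2) (\<theta> @ w\<^sub>1 @ [t\<^sub>2, t\<^sub>1] @ w\<^sub>2))"

definition persistent_at ::
  "('p, 'l, 't, 'v, 'd) program \<Rightarrow> ('p, 'l, 'v, 'd) state \<Rightarrow> ('p, 'l, 'v, 'd) form \<Rightarrow>
     ('p, 'l) point \<Rightarrow> ('p, 'l, 'v, 'd) form \<Rightarrow> 't set \<Rightarrow> bool"
  where "persistent_at P s\<^sub>0 \<psi> pp \<Psi> T \<longleftrightarrow>
    T \<subseteq> schedulable_at P pp \<and>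
    (\<forall>\<theta> s ts s'. derivation P s\<^sub>0 \<theta> s \<longrightarrow> pc s = pp \<longrightarrow> s \<Turnstile> \<Psi> \<longrightarrow>
       derivation P s ts s' \<longrightarrow> set ts \<subseteq> all_transitions P - T \<longrightarrow>
       (\<forall>t\<in>T. \<forall>u\<in>set ts. semi_commutes_after P s\<^sub>0 \<psi> \<theta> t u))"

definition safe_pre ::
  "('p, 'l, 't, 'v, 'd) program \<Rightarrow> ('t \<Rightarrow> ('p, 'l, 'v, 'd) form \<Rightarrow> ('p, 'l, 'v, 'd) form) \<Rightarrow> bool"
  where "safe_pre P pre \<longleftrightarrow> (\<forall>t \<phi> s s'. s \<Turnstile> pre t \<phi> \<longrightarrow> step P s t s' \<longrightarrow> s' \<Turnstile> \<phi>)"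

type_synonym ('p, 'l, 'v, 'd) memo = "('p, 'l) point \<Rightarrow> ('p, 'l, 'v, 'd) form set"

datatype ('p, 'l, 'v, 'd) outcome =
  Error
| Returned "('p, 'l, 'v, 'd) memo" "('p, 'l, 'v, 'd) form"

text \<open>
  Big-step semantics of the search.  \<open>explore P \<psi> PS pre M s r\<close>: started with memo table \<open>M\<close>, the
  call on \<open>s\<close> can end with outcome \<open>r\<close>, where \<open>Returned M' \<Psi>\<close> carries the final memo table and the
  returned formula.  \<open>explore_succs P \<psi> PS pre M s ts \<Psi> r\<close> is the loop over the enabled selected
  transitions, with \<open>ts\<close> those still to be processed and \<open>\<Psi>\<close> the formula accumulated so far.  The
  choice of the memoized formula and the order \<open>ts\<close> of the loop are nondeterministic.
\<close>

inductive
  explore ::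
    "('p, 'l, 't, 'v, 'd) program \<Rightarrow> ('p, 'l, 'v, 'd) form \<Rightarrow>
       (('p, 'l) point \<Rightarrow> 't set \<times> ('p, 'l, 'v, 'd) form) \<Rightarrow>
       ('t \<Rightarrow> ('p, 'l, 'v, 'd) form \<Rightarrow> ('p, 'l, 'v, 'd) form) \<Rightarrow>
       ('p, 'l, 'v, 'd) memo \<Rightarrow> ('p, 'l, 'v, 'd) state \<Rightarrow> ('p, 'l, 'v, 'd) outcome \<Rightarrow> bool" and
  explore_succs ::
    "('p, 'l, 't, 'v, 'd) program \<Rightarrow> ('p, 'l, 'v, 'd) form \<Rightarrow>
       (('p, 'l) point \<Rightarrow> 't set \<times> ('p, 'l, 'v, 'd) form) \<Rightarrow>
       ('t \<Rightarrow> ('p, 'l, 'v, 'd) form \<Rightarrow> ('p, 'l, 'v, 'd) form) \<Rightarrow>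
       ('p, 'l, 'v, 'd) memo \<Rightarrow> ('p, 'l, 'v, 'd) state \<Rightarrow> 't list \<Rightarrow> ('p, 'l, 'v, 'd) form \<Rightarrow>
       ('p, 'l, 'v, 'd) outcome \<Rightarrow> bool"
  for P \<psi> PS pre
where
  memo_hit:
    "\<Psi> \<in> M (pc s) \<Longrightarrow> s \<Turnstile> \<Psi> \<Longrightarrow> explore P \<psi> PS pre M s (Returned M \<Psi>)"
| unsafe:
    "\<forall>\<Psi>\<in>M (pc s). \<not> s \<Turnstile> \<Psi> \<Longrightarrow> \<not> s \<Turnstile> \<psi> \<Longrightarrow> explore P \<psi> PS pre M s Error"
| expand:
    "\<forall>\<Psi>\<in>M (pc s). \<not> s \<Turnstile> \<Psi> \<Longrightarrow> s \<Turnstile> \<psi> \<Longrightarrow>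
     PS (pc s) = (T, \<Psi>\<^sub>t) \<Longrightarrow>
     (Ts, \<Psi>\<^sub>1) = (if s \<Turnstile> \<Psi>\<^sub>t then (T, \<psi> \<and>\<^sub>f \<Psi>\<^sub>t) else (schedulable P s, \<psi>)) \<Longrightarrow>
     \<Psi>\<^sub>2 = \<Psi>\<^sub>1 \<and>\<^sub>f form_Conj ((\<lambda>t. pre t form_false) ` (Ts - enabled P s)) \<Longrightarrow>
     set ts = Ts \<inter> enabled P s \<Longrightarrow> distinct ts \<Longrightarrow>
     explore_succs P \<psi> PS pre M s ts \<Psi>\<^sub>2 r \<Longrightarrow>
     r' = (case r of
             Error \<Rightarrow> Error
           | Returned M' \<Psi> \<Rightarrow> Returned (M'(pc s := insert \<Psi> (M' (pc s)))) \<Psi>) \<Longrightarrow>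
     explore P \<psi> PS pre M s r'"
| succs_Nil:
    "explore_succs P \<psi> PS pre M s [] \<Psi> (Returned M \<Psi>)"
| succs_Error:
    "step P s t s' \<Longrightarrow> explore P \<psi> PS pre M s' Error \<Longrightarrow>
     explore_succs P \<psi> PS pre M s (t # ts) \<Psi> Error"
| succs_Cons:
    "step P s t s' \<Longrightarrow> explore P \<psi> PS pre M s' (Returned M' \<Psi>') \<Longrightarrow>
     explore_succs P \<psi> PS pre M' s ts (\<Psi> \<and>\<^sub>f pre t \<Psi>') r \<Longrightarrow>
     explore_succs P \<psi> PS pre M s (t # ts) \<Psi> r"

end

theory Submission
  imports Defs
begin

text \<open>
  Call a state safe if it satisfies \<open>\<psi>\<close> and every trace through it whose part up to this state
  satisfies \<open>\<psi>\<close> satisfies \<open>\<psi>\<close> as a whole.  By induction on the run of the search, every explored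
  state is safe, and so is every state at \<open>\<ell>\<close> satisfying a formula memoized for \<open>\<ell>\<close>.  Both claims
  are needed, because \<open>pre\<close> may be too strong for the explored state to satisfy the formula
  returned for it.

  The induction step uses that a trace running from \<open>s\<close> to a terminal state must contain a
  transition of the persistent set \<open>T\<close>: by acyclicity, transitions of the same process de-schedule
  each other, so a transition of \<open>T\<close> remains schedulable until one in \<open>T\<close> is executed.  The first
  transition of \<open>T\<close> on the trace can be moved to the front by swaps of neighbours; these preserve
  the property of being a trace, and the coverage relation carries \<open>\<psi>\<close> back along them.  Since
  every derivation extends to a trace, safety of \<open>s\<^sub>0\<close> yields the theorem.
\<close>

section \<open>Derivations, satisfaction and infeasible states\<close>

lemma derivation_Nil_iff [simp]: "derivation P s [] s' \<longleftrightarrow> s' = s"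
  by (auto elim: derivation.cases intro: derivation_Nil)

lemma derivation_Cons_iff:
  "derivation P s (t # \<theta>) s'' \<longleftrightarrow> (\<exists>s'. step P s t s' \<and> derivation P s' \<theta> s'')"
  by (auto elim: derivation.cases intro: derivation_Cons)

lemma derivation_append_iff:
  "derivation P s (\<theta> @ \<theta>') s'' \<longleftrightarrow> (\<exists>s'. derivation P s \<theta> s' \<and> derivation P s' \<theta>' s'')"
  by (induction \<theta> arbitrary: s) (auto simp: derivation_Cons_iff)

lemma step_schedulable: "step P s t s' \<Longrightarrow> t \<in> schedulable P s"
  by (auto simp: step_def schedulable_def schedulable_at_def)

lemma schedulable_step:
  assumes "t \<in> schedulable P s"
  obtains s' where "step P s t s'"
  using assms by (auto simp: step_def schedulable_def schedulable_at_def)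

lemma derivation_transitions: "derivation P s \<theta> s' \<Longrightarrow> set \<theta> \<subseteq> all_transitions P"
  by (induction rule: derivation.induct) (auto simp: step_def all_transitions_def)

lemma sat_conj [simp]: "s \<Turnstile> \<phi> \<and>\<^sub>f \<chi> \<longleftrightarrow> s \<Turnstile> \<phi> \<and> s \<Turnstile> \<chi>"
  by (auto simp: sat_def form_conj_def)

lemma sat_Conj [simp]: "s \<Turnstile> form_Conj \<Phi> \<longleftrightarrow> (\<forall>\<phi>\<in>\<Phi>. s \<Turnstile> \<phi>)"
  by (auto simp: sat_def form_Conj_def)

lemma sat_false [simp]: "s \<Turnstile> form_false \<longleftrightarrow> constr s = {}"
  by (auto simp: sat_def form_false_def)

lemma infeasible_sat: "constr s = {} \<Longrightarrow> s \<Turnstile> \<phi>"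
  by (simp add: sat_def)

lemma infeasible_derivation: "derivation P s \<theta> s' \<Longrightarrow> constr s = {} \<Longrightarrow> constr s' = {}"
  by (induction rule: derivation.induct) (auto simp: step_def)

lemma not_enabled_step_infeasible: "step P s t s' \<Longrightarrow> t \<notin> enabled P s \<Longrightarrow> constr s' = {}"
  by (auto simp: step_def)

lemma schedulable_derivation:
  assumes "derivation P s \<theta> s'" "t \<in> schedulable P s" "\<And>u. u \<in> set \<theta> \<Longrightarrow> \<not> can_deschedule P u t"
  shows "t \<in> schedulable P s'"
  using assms
proof (induction rule: derivation.induct)
  case (derivation_Cons s u s' \<theta> s'')
  from derivation_Cons.prems(2)[of u] derivation_Cons.hyps(1) derivation_Cons.prems(1)
  have "t \<in> schedulable P s'"
    using step_schedulable unfolding can_deschedule_def by fastforce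
  with derivation_Cons show ?case by simp
qed simp

text \<open>A transition that is not enabled can still be executed, so neither executability nor the
  new program point depends on the store. A derivation can therefore be replayed from any state at
  the same point.\<close>

lemma step_pc_cong:
  assumes "step P s t s1" "pc s = pc r"
  shows "\<exists>r1. step P r t r1 \<and> pc r1 = pc s1"
  using assms unfolding step_def by (metis state.sel(1))

lemma derivation_pc_cong:
  assumes "derivation P s \<theta> s1" "pc s = pc r"
  shows "\<exists>r1. derivation P r \<theta> r1 \<and> pc r1 = pc s1"
  using assms
proof (induction arbitrary: r rule: derivation.induct)
  case (derivation_Cons s t s' \<theta> s'')
  then show ?case by (metis derivation_Cons_iff step_pc_cong)
qed auto

lemma is_trace_pc_cong:
  assumes "derivation P s\<^sub>0 \<alpha> s" "derivation P s\<^sub>0 \<beta> r" "pc s = pc r"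
    and "derivation P s v s\<^sub>f" "terminal P s\<^sub>f"
  shows "is_trace P s\<^sub>0 (\<beta> @ v)"
proof -
  obtain r\<^sub>f where "derivation P r v r\<^sub>f" "pc r\<^sub>f = pc s\<^sub>f"
    using derivation_pc_cong assms(3,4) by blast
  with assms show ?thesis
    by (auto simp: is_trace_def derivation_append_iff terminal_def schedulable_def)
qed

section \<open>Determinism, commuting steps and termination in a concurrent program\<close>

context
  fixes P :: "('p::finite, 'l, 't, 'v, 'd) program"
  assumes program: "concurrent_program P"
begin

lemma transitions_unique: "t \<in> transitions P i \<Longrightarrow> t \<in> transitions P j \<Longrightarrow> i = j"
  using program unfolding concurrent_program_def by blast

lemma step_deterministic: "step P s t s1 \<Longrightarrow> step P s t s2 \<Longrightarrow> s1 = s2"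
  unfolding step_def using transitions_unique by blast

lemma step_pc_deterministic:
  "step P s t s1 \<Longrightarrow> step P r t r1 \<Longrightarrow> pc s = pc r \<Longrightarrow> pc s1 = pc r1"
  using step_deterministic step_pc_cong by metis

lemma derivation_deterministic: "derivation P s \<theta> s1 \<Longrightarrow> derivation P s \<theta> s2 \<Longrightarrow> s1 = s2"
proof (induction arbitrary: s2 rule: derivation.induct)
  case (derivation_Cons s t s' \<theta> s'')
  then show ?case using step_deterministic by (metis derivation_Cons_iff)
qed simp

lemma src_neq_tgt:
  assumes "t \<in> transitions P i"
  shows "src P t \<noteq> tgt P t"
proof
  assume "src P t = tgt P t"
  with assms have "(src P t, src P t) \<in> (\<lambda>t. (src P t, tgt P t)) ` transitions P i"
    by force
  then show False
    using program unfolding concurrent_program_def acyclic_def by blast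
qed

text \<open>\<open>u\<close> moves process \<open>i\<close> away from the common source location,
  because a self-loop would be a cycle, and \<open>t\<close> belongs to no other process that could
  still offer it.\<close>

lemma same_process_deschedule:
  assumes "step P s u s'" "u \<in> transitions P i" "t \<in> transitions P i" "t \<in> schedulable P s"
  shows "can_deschedule P u t"
proof -
  have "pc s i = src P u" "pc s' i = tgt P u"
    using assms(1) transitions_unique[OF assms(2)] by (auto simp: step_def)
  moreover have "pc s i = src P t"
    using assms(4) transitions_unique[OF assms(3)]
    by (auto simp: schedulable_def schedulable_at_def)
  ultimately have "t \<notin> schedulable P s'"
    using src_neq_tgt[OF assms(2)] transitions_unique[OF assms(3)]
    by (auto simp: schedulable_def schedulable_at_def)
  then show ?thesis
    using assms(1,4) step_schedulable[OF assms(1)] unfolding can_deschedule_def by blast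
qed

text \<open>The two transitions belong to different processes, so they update different components
  of the program point. Only the points agree after the swap; the constraints may differ.\<close>

lemma swap_steps:
  assumes "step P s u s1" "step P s1 t s2" "t \<in> schedulable P s" "\<not> can_deschedule P u t"
  obtains s1' s2' where "step P s t s1'" "step P s1' u s2'" "pc s2' = pc s2"
proof -
  obtain i where i: "u \<in> transitions P i" "pc s i = src P u" "pc s1 = (pc s)(i := tgt P u)"
    using assms(1) by (auto simp: step_def)
  obtain j where j: "t \<in> transitions P j" "pc s2 = (pc s1)(j := tgt P t)"
    using assms(2) by (auto simp: step_def)
  have "i \<noteq> j"
    using same_process_deschedule[OF assms(1) i(1)] j(1) assms(3,4) by blast
  obtain s1' where s1': "step P s t s1'"
    using schedulable_step assms(3) .
  have pc1: "pc s1' = (pc s)(j := tgt P t)"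
    using s1' transitions_unique[OF j(1)] by (auto simp: step_def)
  with i \<open>i \<noteq> j\<close> have "u \<in> schedulable P s1'"
    by (auto simp: schedulable_def schedulable_at_def)
  then obtain s2' where s2': "step P s1' u s2'"
    by (rule schedulable_step)
  then have "pc s2' = (pc s1')(i := tgt P u)"
    using transitions_unique[OF i(1)] by (auto simp: step_def)
  with that s1' s2' pc1 i(3) j(2) \<open>i \<noteq> j\<close> show ?thesis
    by (metis fun_upd_twist)
qed

text \<open>A termination measure: the locations still ahead of each process in its control-flow
  graph, summed over all processes. A step changes one summand only.\<close>

lemma step_decreases_reachable_locations:
  assumes "step P s t s'"
  shows "(\<Sum>i\<in>UNIV. card (((\<lambda>t. (src P t, tgt P t)) ` transitions P i)\<^sup>+ `` {pc s' i})) <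
         (\<Sum>i\<in>UNIV. card (((\<lambda>t. (src P t, tgt P t)) ` transitions P i)\<^sup>+ `` {pc s i}))"
proof -
  define R where "R = (\<lambda>i. (\<lambda>t. (src P t, tgt P t)) ` transitions P i)"
  obtain i where i: "t \<in> transitions P i" "pc s i = src P t" "pc s' = (pc s)(i := tgt P t)"
    using assms by (auto simp: step_def)
  have edge: "(src P t, tgt P t) \<in> R i" using i(1) by (auto simp: R_def)
  have fin: "finite ((R i)\<^sup>+ `` {src P t})"
    using program by (simp add: R_def concurrent_program_def)
  have "acyclic (R i)" using program by (simp add: R_def concurrent_program_def)
  then have "(tgt P t, tgt P t) \<notin> (R i)\<^sup>+" by (simp add: acyclic_def)
  \<comment> \<open>The inclusion is strict because \<open>tgt P t\<close> lies ahead of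
    \<open>src P t\<close> but, by acyclicity, not ahead of itself.\<close>
  then have "(R i)\<^sup>+ `` {tgt P t} \<subset> (R i)\<^sup>+ `` {src P t}"
    using edge trancl_into_trancl2[OF edge] by blast
  then have less: "card ((R i)\<^sup>+ `` {pc s' i}) < card ((R i)\<^sup>+ `` {pc s i})"
    using psubset_card_mono[OF fin] i by simp
  have "(\<Sum>i\<in>UNIV. card ((R i)\<^sup>+ `` {pc s' i})) < (\<Sum>i\<in>UNIV. card ((R i)\<^sup>+ `` {pc s i}))"
    using less i(3) by (intro sum_strict_mono_ex1) auto
  then show ?thesis by (simp add: R_def)
qed

text \<open>Every derivation thus extends to a trace, which transfers statements about traces to all
  reachable states.\<close>

lemma terminal_derivation_exists: "\<exists>w s'. derivation P s w s' \<and> terminal P s'"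
proof (induction "\<Sum>i\<in>UNIV. card (((\<lambda>t. (src P t, tgt P t)) ` transitions P i)\<^sup>+ `` {pc s i})"
    arbitrary: s rule: less_induct)
  case less
  show ?case
  proof (cases "terminal P s")
    case True
    then show ?thesis using derivation_Nil by blast
  next
    case False
    then obtain t s1 where "step P s t s1"
      using schedulable_step by (metis all_not_in_conv terminal_def)
    moreover from this obtain w s' where "derivation P s1 w s'" "terminal P s'"
      using less step_decreases_reachable_locations by blast
    ultimately show ?thesis
      by (metis derivation_Cons)
  qed
qed

section \<open>Safe states and permutation of traces\<close>

context
  fixes s\<^sub>0 :: "('p, 'l, 'v, 'd) state"
    and \<psi> :: "('p, 'l, 'v, 'd) form"
begin

text \<open>Quantifying over every \<open>\<theta>\<close> that leads to the state makes safety
  independent of the path, so a formula memoized on one path can be reused on another.\<close>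

definition safe_state :: "('p, 'l, 'v, 'd) state \<Rightarrow> bool" where
  "safe_state s \<longleftrightarrow> s \<Turnstile> \<psi> \<and>
     (\<forall>\<theta> w. derivation P s\<^sub>0 \<theta> s \<longrightarrow> trace_sat P s\<^sub>0 \<theta> \<psi> \<longrightarrow> is_trace P s\<^sub>0 (\<theta> @ w) \<longrightarrow>
        trace_sat P s\<^sub>0 (\<theta> @ w) \<psi>)"

definition safe_form :: "('p, 'l) point \<Rightarrow> ('p, 'l, 'v, 'd) form \<Rightarrow> bool" where
  "safe_form pp \<Psi> \<longleftrightarrow> (\<forall>s. pc s = pp \<longrightarrow> s \<Turnstile> \<Psi> \<longrightarrow> safe_state s)"

text \<open>A prefix of \<open>\<theta> @ w\<close> either lies within \<open>\<theta>\<close> or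
  extends it; in the second case determinism identifies the state reached after
  \<open>\<theta>\<close> with \<open>s\<close>.\<close>

lemma trace_sat_append:
  assumes "derivation P s\<^sub>0 \<theta> s"
    and "trace_sat P s\<^sub>0 \<theta> \<psi>"
    and "\<And>w\<^sub>1 w\<^sub>2 s'. w = w\<^sub>1 @ w\<^sub>2 \<Longrightarrow> derivation P s w\<^sub>1 s' \<Longrightarrow> s' \<Turnstile> \<psi>"
  shows "trace_sat P s\<^sub>0 (\<theta> @ w) \<psi>"
  unfolding trace_sat_def
proof (intro allI impI)
  fix \<rho>\<^sub>1 \<rho>\<^sub>2 r
  assume eq: "\<theta> @ w = \<rho>\<^sub>1 @ \<rho>\<^sub>2" and d: "derivation P s\<^sub>0 \<rho>\<^sub>1 r"
  from eq consider us where "\<theta> = \<rho>\<^sub>1 @ us" | us where "\<rho>\<^sub>1 = \<theta> @ us" "w = us @ \<rho>\<^sub>2"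
    unfolding append_eq_append_conv2 by auto
  then show "r \<Turnstile> \<psi>"
  proof cases
    case 1
    then show ?thesis using assms(2) d unfolding trace_sat_def by blast
  next
    case 2
    then have "derivation P s us r"
      using d derivation_deterministic[OF assms(1)] by (auto simp: derivation_append_iff)
    with 2 assms(3) show ?thesis by blast
  qed
qed

lemma trace_sat_snoc:
  assumes "derivation P s\<^sub>0 \<theta> s" "trace_sat P s\<^sub>0 \<theta> \<psi>" "step P s t s'" "s' \<Turnstile> \<psi>"
  shows "trace_sat P s\<^sub>0 (\<theta> @ [t]) \<psi>"
proof (rule trace_sat_append[OF assms(1,2)])
  fix w\<^sub>1 w\<^sub>2 r
  assume "[t] = w\<^sub>1 @ w\<^sub>2" "derivation P s w\<^sub>1 r"
  moreover have "s \<Turnstile> \<psi>"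
    using assms(1,2) unfolding trace_sat_def by (metis append_Nil2)
  moreover have "q \<Turnstile> \<psi>" if "step P s t q" for q
    using step_deterministic[OF assms(3) that] assms(4) by simp
  ultimately show "r \<Turnstile> \<psi>"
    by (auto simp: Cons_eq_append_conv derivation_Cons_iff)
qed

text \<open>Infeasibility persists along derivations, and infeasible states satisfy every formula.
  This disposes of the transitions that the search does not follow because they are not
  enabled.\<close>

lemma infeasible_safe:
  assumes "constr s = {}"
  shows "safe_state s"
  unfolding safe_state_def
proof (intro conjI allI impI)
  show "s \<Turnstile> \<psi>" using assms by (rule infeasible_sat)
next
  fix \<theta> w
  assume "derivation P s\<^sub>0 \<theta> s" "trace_sat P s\<^sub>0 \<theta> \<psi>"
  then show "trace_sat P s\<^sub>0 (\<theta> @ w) \<psi>"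
    by (rule trace_sat_append) (rule infeasible_sat, rule infeasible_derivation[OF _ assms])
qed

text \<open>Induction on \<open>u\<close> from its end: \<open>t\<close> is swapped with its left
  neighbour \<open>x\<close>, and the hypothesis is applied to the shorter prefix with
  \<open>x # v\<close> as the new suffix.\<close>

lemma move_to_front:
  assumes "derivation P s\<^sub>0 \<theta> s" "t \<in> schedulable P s"
    and "\<And>x. x \<in> set u \<Longrightarrow> semi_commutes_after P s\<^sub>0 \<psi> \<theta> t x"
    and "is_trace P s\<^sub>0 (\<theta> @ u @ t # v)"
  shows "is_trace P s\<^sub>0 (\<theta> @ t # u @ v) \<and>
    (trace_sat P s\<^sub>0 (\<theta> @ t # u @ v) \<psi> \<longrightarrow> trace_sat P s\<^sub>0 (\<theta> @ u @ t # v) \<psi>)"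
  using assms(3,4)
proof (induction u arbitrary: v rule: rev_induct)
  case (snoc x u)
  obtain s\<^sub>f where "derivation P s\<^sub>0 (\<theta> @ u @ [x, t] @ v) s\<^sub>f" and sf: "terminal P s\<^sub>f"
    using snoc.prems(2) by (auto simp: is_trace_def)
  then obtain a b c where a: "derivation P s u a" and b: "step P a x b" and c: "step P b t c"
    and v: "derivation P c v s\<^sub>f"
    using derivation_deterministic[OF assms(1)]
    by (fastforce simp: derivation_append_iff derivation_Cons_iff)
  have nd: "\<not> can_deschedule P y t" if "y \<in> set (u @ [x])" for y
    using snoc.prems(1)[OF that] by (simp add: semi_commutes_after_def)
  have "t \<in> schedulable P a"
    using schedulable_derivation[OF a assms(2)] nd by simp
  with b c obtain b' c' where sw: "step P a t b'" "step P b' x c'" "pc c' = pc c"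
    using swap_steps nd by (metis in_set_conv_decomp)
  have orig: "derivation P s\<^sub>0 (\<theta> @ u @ [x, t]) c"
    and swapped: "derivation P s\<^sub>0 (\<theta> @ u @ [t, x]) c'"
    using assms(1) a b c sw by (auto simp: derivation_append_iff derivation_Cons_iff)
  \<comment> \<open>Both orders end at the same program point, so the suffix \<open>v\<close> can be
    replayed up to a terminal state.\<close>
  have tr: "is_trace P s\<^sub>0 (\<theta> @ u @ [t, x] @ v)"
    using is_trace_pc_cong[OF orig swapped sw(3)[symmetric] v sf] by simp
  have "covers P s\<^sub>0 \<psi> (\<theta> @ u @ [t, x] @ v) (\<theta> @ u @ [x, t] @ v)"
    using snoc.prems tr by (simp add: semi_commutes_after_def)
  with snoc.IH[of "x # v"] snoc.prems(1) tr show ?case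
    by (simp add: covers_def)
qed simp

text \<open>Otherwise persistence applies to all of \<open>w\<close>, so a transition of
  \<open>T\<close> is never de-scheduled and is still schedulable in the terminal state.\<close>

lemma persistent_meets_trace:
  assumes "derivation P s\<^sub>0 \<theta> s" "persistent_at P s\<^sub>0 \<psi> (pc s) \<Psi> T" "s \<Turnstile> \<Psi>"
    and "T \<noteq> {}" "derivation P s w s\<^sub>f" "terminal P s\<^sub>f"
  shows "\<exists>t\<in>set w. t \<in> T"
proof (rule ccontr)
  assume "\<not> (\<exists>t\<in>set w. t \<in> T)"
  then have w: "set w \<subseteq> all_transitions P - T"
    using derivation_transitions[OF assms(5)] by blast
  obtain t where t: "t \<in> T" using assms(4) by blast
  have "\<forall>u\<in>set w. semi_commutes_after P s\<^sub>0 \<psi> \<theta> t u"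
    using assms(1,2,3,5) t w unfolding persistent_at_def by blast
  then have "\<not> can_deschedule P u t" if "u \<in> set w" for u
    using that by (auto simp: semi_commutes_after_def)
  moreover have "t \<in> schedulable P s"
    using assms(2) t unfolding persistent_at_def schedulable_def by blast
  ultimately have "t \<in> schedulable P s\<^sub>f"
    using schedulable_derivation[OF assms(5)] by blast
  then show False using assms(6) by (simp add: terminal_def)
qed

text \<open>The common core of both inductive claims: it is applied to the explored state and to any
  other state that satisfies the formula returned for it.\<close>

lemma safe_state_persistent:
  assumes "s \<Turnstile> \<psi>"
    and pers: "persistent_at P s\<^sub>0 \<psi> (pc s) \<Psi> T" and "s \<Turnstile> \<Psi>"
    and ne: "schedulable P s \<noteq> {} \<Longrightarrow> T \<noteq> {}"
    and succ: "\<And>t s'. t \<in> T \<Longrightarrow> step P s t s' \<Longrightarrow> safe_state s'"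
  shows "safe_state s"
  unfolding safe_state_def
proof (intro conjI allI impI)
  fix \<theta> w
  assume d: "derivation P s\<^sub>0 \<theta> s" and sat: "trace_sat P s\<^sub>0 \<theta> \<psi>" and tr: "is_trace P s\<^sub>0 (\<theta> @ w)"
  obtain s\<^sub>f where w: "derivation P s w s\<^sub>f" and sf: "terminal P s\<^sub>f"
    using tr derivation_deterministic[OF d]
    by (auto simp: is_trace_def derivation_append_iff)
  show "trace_sat P s\<^sub>0 (\<theta> @ w) \<psi>"
  proof (cases w)
    case Nil
    with sat show ?thesis by simp
  next
    case Cons
    with w have "schedulable P s \<noteq> {}"
      using step_schedulable by (force simp: derivation_Cons_iff)
    then have "\<exists>t\<in>set w. t \<in> T"
      using persistent_meets_trace[OF d pers \<open>s \<Turnstile> \<Psi>\<close> ne w sf] by blast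
    then obtain u t v where split: "w = u @ t # v" "t \<in> T" "\<forall>x\<in>set u. x \<notin> T"
      using split_list_first_prop[of w "\<lambda>t. t \<in> T"] by auto
    obtain s1 where u: "derivation P s u s1"
      using w split(1) by (auto simp: derivation_append_iff)
    then have "set u \<subseteq> all_transitions P - T"
      using derivation_transitions split(3) by blast
    then have sc: "semi_commutes_after P s\<^sub>0 \<psi> \<theta> t x" if "x \<in> set u" for x
      using d pers \<open>s \<Turnstile> \<Psi>\<close> u split(2) that unfolding persistent_at_def by blast
    have t: "t \<in> schedulable P s"
      using pers split(2) unfolding persistent_at_def schedulable_def by blast
    then obtain s' where s': "step P s t s'" by (rule schedulable_step)
    have d': "derivation P s\<^sub>0 (\<theta> @ [t]) s'"
      using d s' by (auto simp: derivation_append_iff derivation_Cons_iff)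
    have front: "is_trace P s\<^sub>0 (\<theta> @ t # u @ v) \<and>
        (trace_sat P s\<^sub>0 (\<theta> @ t # u @ v) \<psi> \<longrightarrow> trace_sat P s\<^sub>0 (\<theta> @ u @ t # v) \<psi>)"
      using move_to_front[OF d t sc] tr split(1) by simp
    have safe': "safe_state s'" using succ split(2) s' .
    then have "trace_sat P s\<^sub>0 (\<theta> @ [t]) \<psi>"
      using trace_sat_snoc[OF d sat s'] by (simp add: safe_state_def)
    \<comment> \<open>The permuted trace is regrouped with prefix \<open>\<theta> @ [t]\<close>,
      which leads to \<open>s'\<close>, so that the safety of \<open>s'\<close> covers the
      rest.\<close>
    then have "trace_sat P s\<^sub>0 ((\<theta> @ [t]) @ u @ v) \<psi>"
      using safe' d' front unfolding safe_state_def by (metis append_Cons append_Nil append_assoc)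
    with front split(1) show ?thesis by simp
  qed
qed (fact assms(1))

text \<open>A nonempty derivation starts with a schedulable transition, so only the empty one avoids
  the whole set. This serves the branch in which the search selects all schedulable
  transitions.\<close>

lemma persistent_schedulable: "persistent_at P s\<^sub>0 \<psi> pp \<Psi> (schedulable_at P pp)"
  unfolding persistent_at_def
proof (intro conjI allI impI)
  fix \<theta> s ts s'
  assume "pc s = pp" "derivation P s ts s'" "set ts \<subseteq> all_transitions P - schedulable_at P pp"
  then have "ts = []"
    by (cases ts) (use step_schedulable in \<open>fastforce simp: derivation_Cons_iff schedulable_def\<close>)+
  then show "\<forall>t\<in>schedulable_at P pp. \<forall>u\<in>set ts. semi_commutes_after P s\<^sub>0 \<psi> \<theta> t u"
    by simp
qed simp

section \<open>Soundness of the search\<close>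

definition safe_memo :: "('p, 'l, 'v, 'd) memo \<Rightarrow> bool" where
  "safe_memo M \<longleftrightarrow> (\<forall>pp. \<forall>\<Psi>\<in>M pp. safe_form pp \<Psi>)"

text \<open>The claim about the loop speaks of all states \<open>q\<close> at the point of
  \<open>s\<close>, since the final formula is memoized for that point. It also records that
  \<open>\<Psi>\<close> implies \<open>\<Psi>\<^sub>0\<close>, so that conjuncts collected earlier
  remain available.\<close>

lemma explore_safe:
  assumes PS: "\<And>pp. persistent_at P s\<^sub>0 \<psi> pp (snd (PS pp)) (fst (PS pp))"
    and PS_nonempty: "\<And>pp. schedulable_at P pp \<noteq> {} \<Longrightarrow> fst (PS pp) \<noteq> {}"
    and pre: "safe_pre P pre"
  shows "explore P \<psi> PS pre M s r \<Longrightarrow> safe_memo M \<Longrightarrow>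
           (\<forall>M' \<Psi>. r = Returned M' \<Psi> \<longrightarrow>
              safe_memo M' \<and> safe_state s \<and> safe_form (pc s) \<Psi>)"
    and "explore_succs P \<psi> PS pre M s ts \<Psi>\<^sub>0 r' \<Longrightarrow> safe_memo M \<Longrightarrow>
           (\<forall>M' \<Psi>. r' = Returned M' \<Psi> \<longrightarrow>
              safe_memo M' \<and>
              (\<forall>t\<in>set ts. \<forall>s'. step P s t s' \<longrightarrow> safe_state s') \<and>
              (\<forall>q. pc q = pc s \<longrightarrow> q \<Turnstile> \<Psi> \<longrightarrow>
                 q \<Turnstile> \<Psi>\<^sub>0 \<and> (\<forall>t\<in>set ts. \<forall>q'. step P q t q' \<longrightarrow> safe_state q')))"
proof (induction M s r and M s ts \<Psi>\<^sub>0 r' rule: explore_explore_succs.inducts)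
  case (memo_hit \<Psi> M s)
  then show ?case by (auto simp: safe_memo_def safe_form_def)
next
  case (unsafe M s)
  then show ?case by simp
next
  case (expand M s T \<Psi>\<^sub>t Ts \<Psi>\<^sub>1 \<Psi>\<^sub>2 ts r r')
  show ?case
  proof (intro allI impI)
    fix M'' \<Psi>
    assume "r' = Returned M'' \<Psi>"
    then obtain M' where r: "r = Returned M' \<Psi>" and M'': "M'' = M'(pc s := insert \<Psi> (M' (pc s)))"
      using expand(3) by (auto split: outcome.splits)
    have M': "safe_memo M'"
      and succ: "\<And>t s'. t \<in> set ts \<Longrightarrow> step P s t s' \<Longrightarrow> safe_state s'"
      and form: "\<And>q. pc q = pc s \<Longrightarrow> q \<Turnstile> \<Psi> \<Longrightarrow> q \<Turnstile> \<Psi>\<^sub>2"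
      and form_succ: "\<And>q t q'. pc q = pc s \<Longrightarrow> q \<Turnstile> \<Psi> \<Longrightarrow> t \<in> set ts \<Longrightarrow> step P q t q' \<Longrightarrow>
        safe_state q'"
      using expand(10,11) r by blast+
    \<comment> \<open>The formula under which \<open>Ts\<close> is persistent, chosen to treat both
      branches at once; it is trivially true when all schedulable transitions are selected.\<close>
    define \<Phi> where "\<Phi> = (if s \<Turnstile> \<Psi>\<^sub>t then \<Psi>\<^sub>t else (\<lambda>_. True))"
    have \<Psi>\<^sub>1: "q \<Turnstile> \<Psi>\<^sub>1 \<Longrightarrow> q \<Turnstile> \<psi> \<and> q \<Turnstile> \<Phi>" for q
      using expand(6) by (auto simp: \<Phi>_def sat_def form_conj_def split: if_splits)
    have pers: "persistent_at P s\<^sub>0 \<psi> (pc s) \<Phi> Ts"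
      using expand(5,6) PS[of "pc s"] persistent_schedulable
      by (auto simp: \<Phi>_def schedulable_def split: if_splits)
    have ne: "Ts \<noteq> {}" if "schedulable P s \<noteq> {}"
      using that expand(5,6) PS_nonempty[of "pc s"]
      by (auto simp: schedulable_def split: if_splits)
    have "safe_state s"
    proof (rule safe_state_persistent[OF \<open>s \<Turnstile> \<psi>\<close> pers _ ne])
      show "s \<Turnstile> \<Phi>" by (simp add: \<Phi>_def sat_def)
    next
      fix t s'
      assume t: "t \<in> Ts" and step: "step P s t s'"
      show "safe_state s'"
      proof (cases "t \<in> enabled P s")
        case True
        then show ?thesis using succ t step expand(8) by blast
      next
        case False
        then show ?thesis using not_enabled_step_infeasible[OF step] infeasible_safe by blast
      qed
    qed
    moreover have "safe_form (pc s) \<Psi>"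
      unfolding safe_form_def
    proof (intro allI impI)
      fix q
      assume q: "pc q = pc s" "q \<Turnstile> \<Psi>"
      then have \<Psi>\<^sub>2: "q \<Turnstile> \<Psi>\<^sub>1" "\<And>t. t \<in> Ts - enabled P s \<Longrightarrow> q \<Turnstile> pre t form_false"
        using form[OF q] expand(7) by auto
      show "safe_state q"
      proof (rule safe_state_persistent[of _ \<Phi> Ts])
        show "q \<Turnstile> \<psi>" "q \<Turnstile> \<Phi>" using \<Psi>\<^sub>1 \<Psi>\<^sub>2(1) by auto
        show "persistent_at P s\<^sub>0 \<psi> (pc q) \<Phi> Ts" using pers q by simp
        show "Ts \<noteq> {}" if "schedulable P q \<noteq> {}" using ne that q by (simp add: schedulable_def)
      next
        fix t q'
        assume t: "t \<in> Ts" and q': "step P q t q'"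
        show "safe_state q'"
        \<comment> \<open>The split is on enabledness at \<open>s\<close>, not at \<open>q\<close>,
          because \<open>s\<close> determined which conjunct was added for \<open>t\<close>.\<close>
        proof (cases "t \<in> enabled P s")
          case True
          with t have "t \<in> set ts" using expand(8) by blast
          then show ?thesis using form_succ q q' by blast
        next
          case False
          then have "q' \<Turnstile> form_false"
            using \<Psi>\<^sub>2(2) t q' pre unfolding safe_pre_def by blast
          then show ?thesis by (simp add: infeasible_safe)
        qed
      qed
    qed
    ultimately show "safe_memo M'' \<and> safe_state s \<and> safe_form (pc s) \<Psi>"
      using M' M'' by (auto simp: safe_memo_def)
  qed
next
  case (succs_Nil M s \<Psi>)
  then show ?case by simp
next
  case (succs_Error s t s' M ts \<Psi>)
  then show ?case by simp
next
  case (succs_Cons s t s' M M' \<Psi>' ts \<Psi> r)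
  have t: "safe_memo M'" "safe_state s'" "safe_form (pc s') \<Psi>'"
    using succs_Cons(3,6) by auto
  have s: "safe_state s1" if "step P s t s1" for s1
    using that step_deterministic[OF succs_Cons(1)] t(2) by blast
  \<comment> \<open>\<open>q'\<close> lies at the point of \<open>s'\<close> and satisfies
    \<open>\<Psi>'\<close> by safety of \<open>pre\<close>, so \<open>safe_form\<close> applies to
    it.\<close>
  have q: "safe_state q'" if "pc q = pc s" "q \<Turnstile> pre t \<Psi>'" "step P q t q'" for q q'
    using that step_pc_deterministic[OF succs_Cons(1)] t(3) pre
    unfolding safe_form_def safe_pre_def by metis
  show ?case
  proof (intro allI impI)
    fix M'' \<Phi>
    assume "r = Returned M'' \<Phi>"
    then have IH: "safe_memo M''" "\<forall>t\<in>set ts. \<forall>s'. step P s t s' \<longrightarrow> safe_state s'"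
      "\<forall>q. pc q = pc s \<longrightarrow> q \<Turnstile> \<Phi> \<longrightarrow>
         q \<Turnstile> \<Psi> \<and>\<^sub>f pre t \<Psi>' \<and> (\<forall>t\<in>set ts. \<forall>q'. step P q t q' \<longrightarrow> safe_state q')"
      using succs_Cons(5) t(1) by blast+
    with s q show "safe_memo M'' \<and>
        (\<forall>t\<in>set (t # ts). \<forall>s'. step P s t s' \<longrightarrow> safe_state s') \<and>
        (\<forall>q. pc q = pc s \<longrightarrow> q \<Turnstile> \<Phi> \<longrightarrow>
           q \<Turnstile> \<Psi> \<and> (\<forall>t\<in>set (t # ts). \<forall>q'. step P q t q' \<longrightarrow> safe_state q'))"
      by simp
  qed
qed

lemma safe_initial_state:
  assumes "safe_state s\<^sub>0" "reachable P s\<^sub>0 s"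
  shows "s \<Turnstile> \<psi>"
proof -
  obtain \<theta> where \<theta>: "derivation P s\<^sub>0 \<theta> s"
    using assms(2) by (auto simp: reachable_def)
  obtain w s\<^sub>f where "derivation P s w s\<^sub>f" "terminal P s\<^sub>f"
    using terminal_derivation_exists by blast
  \<comment> \<open>The empty list serves as the prefix leading to \<open>s\<^sub>0\<close> in
    \<open>safe_state\<close>.\<close>
  with \<theta> have tr: "is_trace P s\<^sub>0 ([] @ \<theta> @ w)"
    by (auto simp: is_trace_def derivation_append_iff)
  have "trace_sat P s\<^sub>0 [] \<psi>"
    using assms(1) by (simp add: trace_sat_def safe_state_def)
  then have "trace_sat P s\<^sub>0 (\<theta> @ w) \<psi>"
    using assms(1) derivation_Nil[of P s\<^sub>0] tr unfolding safe_state_def by (metis append_Nil)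
  then show ?thesis using \<theta> unfolding trace_sat_def by blast
qed

end

end

theorem theorem2:
  fixes P :: "('p::finite, 'l, 't, 'v, 'd) program"
    and s\<^sub>0 :: "('p, 'l, 'v, 'd) state"
    and \<psi> :: "('p, 'l, 'v, 'd) form"
    and PS :: "('p, 'l) point \<Rightarrow> 't set \<times> ('p, 'l, 'v, 'd) form"
    and pre :: "'t \<Rightarrow> ('p, 'l, 'v, 'd) form \<Rightarrow> ('p, 'l, 'v, 'd) form"
    and M :: "('p, 'l, 'v, 'd) memo"
    and \<Psi> :: "('p, 'l, 'v, 'd) form"
  assumes "concurrent_program P"
    and "\<And>pp. persistent_at P s\<^sub>0 \<psi> pp (snd (PS pp)) (fst (PS pp))"
    and "\<And>pp. schedulable_at P pp \<noteq> {} \<Longrightarrow> fst (PS pp) \<noteq> {}"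
    and "safe_pre P pre"
    and "explore P \<psi> PS pre (\<lambda>_. {}) s\<^sub>0 (Returned M \<Psi>)"
  shows "\<forall>s. reachable P s\<^sub>0 s \<longrightarrow> s \<Turnstile> \<psi>"
proof (intro allI impI)
  fix s
  assume "reachable P s\<^sub>0 s"
  moreover have "safe_state P s\<^sub>0 \<psi> s\<^sub>0"
    \<comment> \<open>The search starts with an empty memo table, which is vacuously safe.\<close>
    using explore_safe(1)[OF assms(1) assms(2-5)] by (simp add: safe_memo_def[OF assms(1)])
  ultimately show "s \<Turnstile> \<psi>"
    using safe_initial_state[OF assms(1)] by blast
qed

end
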